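(* Let $(U,\mathscr{B})$, $\Gamma$, $\Gamma^*$, $S\subseteq\mathbb{R}^r$, $A,B:S\times U\to\mathbb{R}$, $I_\alpha(\Psi)$ and $C(\alpha,u)$ be as described in the context, with $S$ and $U$ nonempty. Assume: (i) the integrals $\int_U A(\alpha,u)\,d\Psi(u)$ and $\int_U B(\alpha,u)\,d\Psi(u)$ exist for all $\Psi\in\Gamma$, $\alpha\in S$; (ii) $\Gamma^*\subset\Gamma$ (every degenerate probability measure belongs to $\Gamma$); (iii) $B$ is strictly of constant sign: either $B(\alpha,u)>0$ for all $(\alpha,u)\in S\times U$, or $B(\alpha,u)<0$ for all $(\alpha,u)\in S\times U$. Then the following assertions hold. 1. If the test function $C(\alpha,u)=A(\alpha,u)/B(\alpha,u)$ is bounded above on $S\times U$ and does not attain its global maximum on $S\times U$, then for every $\varepsilon>0$ there exist $\alpha^{(+)}(\varepsilon)\in S$ and $u^{(+)}(\varepsilon)\in U$ such that $$\sup_{(\alpha,\Psi)\in S\times\Gamma}I_\alpha(\Psi)-\varepsilon< I_{\alpha^{(+)}(\varepsilon)}\left(\Psi^*_{u^{(+)}(\varepsilon)}\right)=\frac{A\left(\alpha^{(+)}(\varepsilon),u^{(+)}(\varepsilon)\right)}{B\left(\alpha^{(+)}(\varepsilon),u^{(+)}(\varepsilon)\right)}<\sup_{(\alpha,\Psi)\in S\times\Gamma}I_\alpha(\Psi),$$ where $\Psi^*_{u^{(+)}(\varepsilon)}\in\Gamma$ is the degenerate probability measure concentrated at $u^{(+)}(\varepsilon)$. 2. If the test function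 $C(\alpha,u)$ is bounded below on $S\times U$ and does not attain its global minimum on $S\times U$, then for every $\varepsilon>0$ there exist $\alpha^{(-)}(\varepsilon)\in S$ and $u^{(-)}(\varepsilon)\in U$ such that $$\inf_{(\alpha,\Psi)\in S\times\Gamma}I_\alpha(\Psi)< I_{\alpha^{(-)}(\varepsilon)}\left(\Psi^*_{u^{(-)}(\varepsilon)}\right)=\frac{A\left(\alpha^{(-)}(\varepsilon),u^{(-)}(\varepsilon)\right)}{B\left(\alpha^{(-)}(\varepsilon),u^{(-)}(\varepsilon)\right)}<\inf_{(\alpha,\Psi)\in S\times\Gamma}I_\alpha(\Psi)+\varepsilon,$$ where $\Psi^*_{u^{(-)}(\varepsilon)}\in\Gamma$ is the degenerate probability measure concentrated at $u^{(-)}(\varepsilon)$.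
   Context: $(U,\mathscr{B})$ is a measurable space: $U$ is an arbitrary set and $\mathscr{B}$ is a $\sigma$-algebra of subsets of $U$ containing all singletons. $\Gamma$ is a set of probability measures on $\mathscr{B}$. A probability measure $\Psi^*$ on $\mathscr{B}$ is called degenerate if there is a point $u^*\in U$ (the concentration point) such that $\Psi^*(\{u^*\})=1$ and $\Psi^*(B^* )=0$ for every $B^*\in\mathscr{B}$ not containing $u^*$; it is then denoted $\Psi^*_{u^*}$. $\Gamma^*$ is the set of all degenerate probability measures on $(U,\mathscr{B})$. $S\subseteq\mathbb{R}^r$ is a set of values of a vector parameter $\alpha$. $A,B:S\times U\to\mathbb{R}$ are measurable functions. For $\alpha\in S$, $\Psi\in\Gamma$ put $$I_\alpha(\Psi)=\frac{\int_U A(\alpha,u)\,d\Psi(u)}{\int_U B(\alpha,u)\,d\Psi(u)},$$ where the integrals are Lebesgue integrals with respect to $\Psi$ and "exist" means they exist with finite real values. The test function is $C(\alpha,u)=A(\alpha,u)/B(\alpha,u)$, $(\alpha,u)\in S\times U$. *)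

theory Defs
  imports "HOL-Probability.Probability"
begin

text \<open>
  A measurable space is represented by a measure \<open>M\<close> of which only \<open>space M\<close> and \<open>sets M\<close>
  are used; a probability measure on it is some \<open>P\<close> with \<open>prob_space P\<close> and
  \<open>sets P = sets M\<close> (hence \<open>space P = space M\<close>).
\<close>

definition prob_measures_on :: "'u measure \<Rightarrow> 'u measure set" where
  "prob_measures_on M = {P. prob_space P \<and> sets P = sets M}"

definition degenerate_at :: "'u measure \<Rightarrow> 'u \<Rightarrow> 'u measure \<Rightarrow> bool" where
  "degenerate_at M u P \<longleftrightarrow>
     P \<in> prob_measures_on M \<and> u \<in> space M \<and> measure P {u} = 1 \<and>
     (\<forall>E\<in>sets M. u \<notin> E \<longrightarrow> measure P E = 0)"

definition degenerate_measures :: "'u measure \<Rightarrow> 'u measure set" where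
  "degenerate_measures M = {P. \<exists>u. degenerate_at M u P}"

text \<open>
  The degenerate measure concentrated at \<open>u\<close> is unique, and it is the library's \<open>return M u\<close>.
\<close>

lemma degenerate_at_iff_return:
  assumes u: "u \<in> space M" and singletons: "\<And>v. v \<in> space M \<Longrightarrow> {v} \<in> sets M"
  shows "degenerate_at M u P \<longleftrightarrow> P = return M u"
proof
  assume "P = return M u"
  moreover have "prob_space (return M u)"
    using u by (rule prob_space_return)
  ultimately show "degenerate_at M u P"
    using u singletons[OF u]
    by (auto simp: degenerate_at_def prob_measures_on_def measure_return)
next
  assume deg: "degenerate_at M u P"
  then interpret prob_space P
    by (simp add: degenerate_at_def prob_measures_on_def)
  have sets_P: "sets P = sets M"
    using deg by (simp add: degenerate_at_def prob_measures_on_def)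
  show "P = return M u"
  proof (rule measure_eqI)
    show "sets P = sets (return M u)"
      using sets_P by simp
    fix E assume "E \<in> sets P"
    then have E: "E \<in> sets M" using sets_P by simp
    have "measure P E = indicator E u"
    proof (cases "u \<in> E")
      case True
      then have "measure P {u} \<le> measure P E"
        using \<open>E \<in> sets P\<close> by (intro finite_measure_mono) auto
      then have "measure P E = 1"
        using deg by (intro antisym prob_le_1) (simp add: degenerate_at_def)
      then show ?thesis using True by simp
    next
      case False
      then show ?thesis using deg E by (simp add: degenerate_at_def)
    qed
    then show "emeasure P E = emeasure (return M u) E"
      using E by (simp add: emeasure_eq_measure split: split_indicator)
  qed
qed

definition ratio_functional ::
    "('a \<times> 'u \<Rightarrow> real) \<Rightarrow> ('a \<times> 'u \<Rightarrow> real) \<Rightarrow> 'a \<Rightarrow> 'u measure \<Rightarrow> real" where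
  "ratio_functional A B \<alpha> \<Psi> = (\<integral>u. A (\<alpha>, u) \<partial>\<Psi>) / (\<integral>u. B (\<alpha>, u) \<partial>\<Psi>)"

definition test_function ::
    "('a \<times> 'u \<Rightarrow> real) \<Rightarrow> ('a \<times> 'u \<Rightarrow> real) \<Rightarrow> 'a \<times> 'u \<Rightarrow> real" where
  "test_function A B p = A p / B p"

definition attains_max_on :: "('p \<Rightarrow> real) \<Rightarrow> 'p set \<Rightarrow> bool" where
  "attains_max_on f X \<longleftrightarrow> (\<exists>p\<in>X. \<forall>q\<in>X. f q \<le> f p)"

definition attains_min_on :: "('p \<Rightarrow> real) \<Rightarrow> 'p set \<Rightarrow> bool" where
  "attains_min_on f X \<longleftrightarrow> (\<exists>p\<in>X. \<forall>q\<in>X. f p \<le> f q)"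

text \<open>
  The supremum and infimum are taken in \<open>ereal\<close>, because \<open>Sup\<close> and \<open>Inf\<close> on \<open>real\<close> are
  meaningless for unbounded sets.
\<close>

definition sup_functional ::
    "('a \<times> 'u \<Rightarrow> real) \<Rightarrow> ('a \<times> 'u \<Rightarrow> real) \<Rightarrow> 'a set \<Rightarrow> 'u measure set \<Rightarrow> ereal" where
  "sup_functional A B S \<Gamma> = (SUP (\<alpha>, \<Psi>)\<in>S \<times> \<Gamma>. ereal (ratio_functional A B \<alpha> \<Psi>))"

definition inf_functional ::
    "('a \<times> 'u \<Rightarrow> real) \<Rightarrow> ('a \<times> 'u \<Rightarrow> real) \<Rightarrow> 'a set \<Rightarrow> 'u measure set \<Rightarrow> ereal" where
  "inf_functional A B S \<Gamma> = (INF (\<alpha>, \<Psi>)\<in>S \<times> \<Gamma>. ereal (ratio_functional A B \<alpha> \<Psi>))"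

end

theory Submission
  imports Defs
begin

text \<open>
  A ratio of integrals \<open>(\<integral>f) / (\<integral>g)\<close> with \<open>g\<close> of constant sign is a weighted average of \<open>f / g\<close>,
  with weight \<open>g / \<integral>g\<close>. It therefore never exceeds an upper bound of \<open>f / g\<close>
  (\<open>ratio_of_integrals_le\<close>). Conversely, at a degenerate measure the functional takes exactly the
  value of the test function at the concentration point, and all degenerate measures are admissible.
  Hence the functional and the test function have the same supremum (\<open>sup_functional_eq_Sup\<close>).
  A supremum that is not attained is approached within any \<open>\<epsilon>\<close> by values strictly below it, and
  the point where the test function takes such a value gives the required degenerate measure.

  The assertion about the infimum is the one about the supremum for \<open>-A\<close> in place of \<open>A\<close>, since
  this changes the sign of both the functional and the test function.
\<close>

text \<open>
  For \<open>g > 0\<close>, integrating \<open>f \<le> c * g\<close> and dividing by \<open>\<integral>g > 0\<close> suffices. Replacing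
  \<open>(f, g)\<close> by \<open>(-f, -g)\<close> leaves both quotients unchanged, so negative \<open>g\<close> reduces to this case.
\<close>

lemma (in prob_space) ratio_of_integrals_le:
  fixes f g :: "'a \<Rightarrow> real"
  assumes f: "integrable M f" and g: "integrable M g"
    and sign: "(\<forall>x\<in>space M. g x > 0) \<or> (\<forall>x\<in>space M. g x < 0)"
    and le: "\<And>x. x \<in> space M \<Longrightarrow> f x / g x \<le> c"
  shows "(\<integral>x. f x \<partial>M) / (\<integral>x. g x \<partial>M) \<le> c"
proof -
  have positive: "(\<integral>x. f' x \<partial>M) / (\<integral>x. g' x \<partial>M) \<le> c"
    if f': "integrable M f'" and g': "integrable M g'"
      and pos: "\<And>x. x \<in> space M \<Longrightarrow> g' x > 0"
      and le': "\<And>x. x \<in> space M \<Longrightarrow> f' x / g' x \<le> c" for f' g' :: "'a \<Rightarrow> real"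
  proof -
    have "(\<integral>x. 0 \<partial>M) < (\<integral>x. g' x \<partial>M)"
      using g' pos by (intro integral_less_AE_space) (auto simp: emeasure_space_1)
    moreover have "(\<integral>x. f' x \<partial>M) \<le> (\<integral>x. c * g' x \<partial>M)"
      using f' g' le' pos by (intro integral_mono) (auto simp: divide_le_eq)
    ultimately show ?thesis
      by (simp add: divide_le_eq)
  qed
  from sign show ?thesis
  proof
    assume "\<forall>x\<in>space M. g x > 0"
    then show ?thesis using f g le by (intro positive) auto
  next
    assume "\<forall>x\<in>space M. g x < 0"
    then have "(\<integral>x. - f x \<partial>M) / (\<integral>x. - g x \<partial>M) \<le> c"
      using f g le by (intro positive) auto
    then show ?thesis by simp
  qed
qed

lemma return_in_degenerate_measures:
  assumes "\<And>v. v \<in> space M \<Longrightarrow> {v} \<in> sets M" and "u \<in> space M"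
  shows "return M u \<in> degenerate_measures M"
  using assms degenerate_at_iff_return[of u M "return M u"]
  by (auto simp: degenerate_measures_def)

text \<open>
  Measurability of the sections of \<open>A\<close> and \<open>B\<close> comes from their integrability, because the
  \<open>\<sigma>\<close>-algebra of \<open>return M u\<close> is that of \<open>M\<close>.
\<close>

lemma ratio_functional_return:
  assumes u: "u \<in> space M"
    and A: "integrable (return M u) (\<lambda>v. A (\<alpha>, v))"
    and B: "integrable (return M u) (\<lambda>v. B (\<alpha>, v))"
  shows "ratio_functional A B \<alpha> (return M u) = A (\<alpha>, u) / B (\<alpha>, u)"
proof -
  have "(\<lambda>v. A (\<alpha>, v)) \<in> borel_measurable M" "(\<lambda>v. B (\<alpha>, v)) \<in> borel_measurable M"
    using borel_measurable_integrable[OF A] borel_measurable_integrable[OF B] by simp_all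
  with u show ?thesis
    by (simp add: ratio_functional_def integral_return)
qed

text \<open>
  The bound \<open>\<le>\<close> is the averaging inequality at each admissible measure; the bound \<open>\<ge>\<close> comes from
  the degenerate measures, at which the functional takes every value of the test function.
\<close>

lemma sup_functional_eq_Sup:
  fixes A B :: "'a \<times> 'u \<Rightarrow> real"
  assumes singletons: "\<And>u. u \<in> space M \<Longrightarrow> {u} \<in> sets M"
    and nonempty: "S \<times> space M \<noteq> {}"
    and prob: "\<Gamma> \<subseteq> prob_measures_on M"
    and A: "\<And>\<alpha> \<Psi>. \<alpha> \<in> S \<Longrightarrow> \<Psi> \<in> \<Gamma> \<Longrightarrow> integrable \<Psi> (\<lambda>u. A (\<alpha>, u))"
    and B: "\<And>\<alpha> \<Psi>. \<alpha> \<in> S \<Longrightarrow> \<Psi> \<in> \<Gamma> \<Longrightarrow> integrable \<Psi> (\<lambda>u. B (\<alpha>, u))"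
    and degenerate: "degenerate_measures M \<subseteq> \<Gamma>"
    and sign: "(\<forall>p\<in>S \<times> space M. B p > 0) \<or> (\<forall>p\<in>S \<times> space M. B p < 0)"
    and bdd: "bdd_above (test_function A B ` (S \<times> space M))"
  shows "sup_functional A B S \<Gamma> = ereal (SUP p\<in>S \<times> space M. test_function A B p)"
    (is "_ = ereal ?s")
proof (rule antisym)
  show "sup_functional A B S \<Gamma> \<le> ereal ?s"
    unfolding sup_functional_def
  proof (rule SUP_least, clarsimp)
    fix \<alpha> \<Psi> assume \<alpha>: "\<alpha> \<in> S" and \<Psi>: "\<Psi> \<in> \<Gamma>"
    from prob \<Psi> have "prob_space \<Psi>" and "sets \<Psi> = sets M"
      by (auto simp: prob_measures_on_def)
    from sets_eq_imp_space_eq[OF \<open>sets \<Psi> = sets M\<close>] have space: "space \<Psi> = space M" .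
    have "A (\<alpha>, u) / B (\<alpha>, u) \<le> ?s" if "u \<in> space M" for u
      using cSUP_upper[OF _ bdd, of "(\<alpha>, u)"] \<alpha> that by (simp add: test_function_def)
    then show "ratio_functional A B \<alpha> \<Psi> \<le> ?s"
      unfolding ratio_functional_def using A[OF \<alpha> \<Psi>] B[OF \<alpha> \<Psi>] sign \<alpha>
      by (intro prob_space.ratio_of_integrals_le[OF \<open>prob_space \<Psi>\<close>]) (auto simp: space)
  qed
  have test_le: "ereal (test_function A B p) \<le> sup_functional A B S \<Gamma>" if p: "p \<in> S \<times> space M" for p
  proof -
    obtain \<alpha> u where [simp]: "p = (\<alpha>, u)" and \<alpha>: "\<alpha> \<in> S" and u: "u \<in> space M"
      using p by auto
    have \<Gamma>: "return M u \<in> \<Gamma>"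
      using return_in_degenerate_measures[OF singletons u] degenerate by blast
    have "ereal (ratio_functional A B \<alpha> (return M u)) \<le> sup_functional A B S \<Gamma>"
      unfolding sup_functional_def
      using \<alpha> \<Gamma> by (intro SUP_upper2[of "(\<alpha>, return M u)"]) auto
    then show ?thesis
      using ratio_functional_return[OF u A[OF \<alpha> \<Gamma>] B[OF \<alpha> \<Gamma>]]
      by (simp add: test_function_def)
  qed
  obtain p\<^sub>0 where p\<^sub>0: "p\<^sub>0 \<in> S \<times> space M"
    using nonempty by blast
  (* The real supremum is moved through ereal by cases; the value -\<infinity> is ruled out by p\<^sub>0. *)
  show "ereal ?s \<le> sup_functional A B S \<Gamma>"
  proof (cases "sup_functional A B S \<Gamma>")
    case (real r)
    then have "?s \<le> r" using test_le nonempty by (intro cSUP_least) auto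
    with real show ?thesis by simp
  next
    case MInf
    with test_le[OF p\<^sub>0] show ?thesis by simp
  qed simp
qed

lemma unattained_Sup_approached:
  fixes f :: "'p \<Rightarrow> real"
  assumes "X \<noteq> {}" and bdd: "bdd_above (f ` X)" and unattained: "\<not> attains_max_on f X"
    and "\<epsilon> > 0"
  obtains p where "p \<in> X" and "(SUP q\<in>X. f q) - \<epsilon> < f p" and "f p < (SUP q\<in>X. f q)"
proof -
  obtain p where p: "p \<in> X" "(SUP q\<in>X. f q) - \<epsilon> < f p"
    using less_cSUP_iff[OF \<open>X \<noteq> {}\<close> bdd, of "(SUP q\<in>X. f q) - \<epsilon>"] \<open>\<epsilon> > 0\<close> by auto
  obtain q where "q \<in> X" "f p < f q"
    using unattained p(1) by (force simp: attains_max_on_def not_le)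
  with cSUP_upper[OF \<open>q \<in> X\<close> bdd] p that show thesis by force
qed

lemma degenerate_near_sup:
  fixes A B :: "'a \<times> 'u \<Rightarrow> real" and \<epsilon> :: real
  assumes singletons: "\<And>u. u \<in> space M \<Longrightarrow> {u} \<in> sets M"
    and nonempty: "S \<times> space M \<noteq> {}"
    and prob: "\<Gamma> \<subseteq> prob_measures_on M"
    and A: "\<And>\<alpha> \<Psi>. \<alpha> \<in> S \<Longrightarrow> \<Psi> \<in> \<Gamma> \<Longrightarrow> integrable \<Psi> (\<lambda>u. A (\<alpha>, u))"
    and B: "\<And>\<alpha> \<Psi>. \<alpha> \<in> S \<Longrightarrow> \<Psi> \<in> \<Gamma> \<Longrightarrow> integrable \<Psi> (\<lambda>u. B (\<alpha>, u))"
    and degenerate: "degenerate_measures M \<subseteq> \<Gamma>"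
    and sign: "(\<forall>p\<in>S \<times> space M. B p > 0) \<or> (\<forall>p\<in>S \<times> space M. B p < 0)"
    and bdd: "bdd_above (test_function A B ` (S \<times> space M))"
    and unattained: "\<not> attains_max_on (test_function A B) (S \<times> space M)"
    and "\<epsilon> > 0"
  shows "\<exists>\<alpha>\<in>S. \<exists>u\<in>space M. return M u \<in> \<Gamma> \<and>
    sup_functional A B S \<Gamma> - ereal \<epsilon> < ereal (ratio_functional A B \<alpha> (return M u)) \<and>
    ratio_functional A B \<alpha> (return M u) = A (\<alpha>, u) / B (\<alpha>, u) \<and>
    ereal (A (\<alpha>, u) / B (\<alpha>, u)) < sup_functional A B S \<Gamma>"
proof -
  let ?s = "SUP p\<in>S \<times> space M. test_function A B p"
  obtain p where p: "p \<in> S \<times> space M"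
      and near: "?s - \<epsilon> < test_function A B p" "test_function A B p < ?s"
    using unattained_Sup_approached[OF nonempty bdd unattained \<open>\<epsilon> > 0\<close>] by blast
  obtain \<alpha> u where p_eq: "p = (\<alpha>, u)" and \<alpha>: "\<alpha> \<in> S" and u: "u \<in> space M"
    using p by auto
  have \<Gamma>: "return M u \<in> \<Gamma>"
    using return_in_degenerate_measures[OF singletons u] degenerate by blast
  have ratio: "ratio_functional A B \<alpha> (return M u) = A (\<alpha>, u) / B (\<alpha>, u)"
    using ratio_functional_return[OF u A[OF \<alpha> \<Gamma>] B[OF \<alpha> \<Gamma>]] .
  have sup: "sup_functional A B S \<Gamma> = ereal ?s"
    by (rule sup_functional_eq_Sup[OF singletons nonempty prob A B degenerate sign bdd])
  show ?thesis
    using near \<Gamma> unfolding sup p_eq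
    by (intro bexI[OF _ \<alpha>] bexI[OF _ u]) (simp add: ratio test_function_def)
qed

lemma ratio_functional_uminus:
  "ratio_functional (\<lambda>p. - A p) B \<alpha> \<Psi> = - ratio_functional A B \<alpha> \<Psi>"
  by (simp add: ratio_functional_def)

lemma sup_functional_uminus:
  "sup_functional (\<lambda>p. - A p) B S \<Gamma> = - inf_functional A B S \<Gamma>"
  unfolding sup_functional_def inf_functional_def ratio_functional_uminus
  by (simp add: case_prod_unfold ereal_SUP_uminus_eq flip: uminus_ereal.simps(1))

lemma test_function_uminus:
  "test_function (\<lambda>p. - A p) B = (\<lambda>p. - test_function A B p)"
  by (simp add: test_function_def fun_eq_iff)

theorem theorem2:
  fixes M :: "'u measure"
    and \<Gamma> :: "'u measure set"
    and S :: "(real ^ 'r) set"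
    and A B :: "(real ^ 'r) \<times> 'u \<Rightarrow> real"
  assumes singletons: "\<And>u. u \<in> space M \<Longrightarrow> {u} \<in> sets M"
    and U_nonempty: "space M \<noteq> {}"
    and S_nonempty: "S \<noteq> {}"
    and \<Gamma>_prob: "\<Gamma> \<subseteq> prob_measures_on M"
    and A_measurable: "A \<in> borel_measurable (restrict_space borel S \<Otimes>\<^sub>M M)"
    and B_measurable: "B \<in> borel_measurable (restrict_space borel S \<Otimes>\<^sub>M M)"
    and A_integrable: "\<And>\<alpha> \<Psi>. \<alpha> \<in> S \<Longrightarrow> \<Psi> \<in> \<Gamma> \<Longrightarrow> integrable \<Psi> (\<lambda>u. A (\<alpha>, u))"
    and B_integrable: "\<And>\<alpha> \<Psi>. \<alpha> \<in> S \<Longrightarrow> \<Psi> \<in> \<Gamma> \<Longrightarrow> integrable \<Psi> (\<lambda>u. B (\<alpha>, u))"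
    and degenerate: "degenerate_measures M \<subseteq> \<Gamma>"
    and B_sign: "(\<forall>p\<in>S \<times> space M. B p > 0) \<or> (\<forall>p\<in>S \<times> space M. B p < 0)"
  shows
    "(bdd_above (test_function A B ` (S \<times> space M)) \<and>
      \<not> attains_max_on (test_function A B) (S \<times> space M) \<longrightarrow>
      (\<forall>\<epsilon>::real. \<epsilon> > 0 \<longrightarrow> (\<exists>\<alpha>\<in>S. \<exists>u\<in>space M.
         return M u \<in> \<Gamma> \<and>
         sup_functional A B S \<Gamma> - ereal \<epsilon> < ereal (ratio_functional A B \<alpha> (return M u)) \<and>
         ratio_functional A B \<alpha> (return M u) = A (\<alpha>, u) / B (\<alpha>, u) \<and>
         ereal (A (\<alpha>, u) / B (\<alpha>, u)) < sup_functional A B S \<Gamma>))) \<and>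
     (bdd_below (test_function A B ` (S \<times> space M)) \<and>
      \<not> attains_min_on (test_function A B) (S \<times> space M) \<longrightarrow>
      (\<forall>\<epsilon>::real. \<epsilon> > 0 \<longrightarrow> (\<exists>\<alpha>\<in>S. \<exists>u\<in>space M.
         return M u \<in> \<Gamma> \<and>
         inf_functional A B S \<Gamma> < ereal (ratio_functional A B \<alpha> (return M u)) \<and>
         ratio_functional A B \<alpha> (return M u) = A (\<alpha>, u) / B (\<alpha>, u) \<and>
         ereal (A (\<alpha>, u) / B (\<alpha>, u)) < inf_functional A B S \<Gamma> + ereal \<epsilon>)))"
proof (intro conjI impI allI; elim conjE)
  have nonempty: "S \<times> space M \<noteq> {}"
    using U_nonempty S_nonempty by auto
  fix \<epsilon> :: real assume "\<epsilon> > 0"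
  {
    assume "bdd_above (test_function A B ` (S \<times> space M))"
      and "\<not> attains_max_on (test_function A B) (S \<times> space M)"
    then show "\<exists>\<alpha>\<in>S. \<exists>u\<in>space M. return M u \<in> \<Gamma> \<and>
        sup_functional A B S \<Gamma> - ereal \<epsilon> < ereal (ratio_functional A B \<alpha> (return M u)) \<and>
        ratio_functional A B \<alpha> (return M u) = A (\<alpha>, u) / B (\<alpha>, u) \<and>
        ereal (A (\<alpha>, u) / B (\<alpha>, u)) < sup_functional A B S \<Gamma>"
      using degenerate_near_sup[OF singletons nonempty \<Gamma>_prob A_integrable B_integrable
        degenerate B_sign _ _ \<open>\<epsilon> > 0\<close>] by blast
  }
  {
    assume bdd: "bdd_below (test_function A B ` (S \<times> space M))"
      and unattained: "\<not> attains_min_on (test_function A B) (S \<times> space M)"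
    have "bdd_above (test_function (\<lambda>p. - A p) B ` (S \<times> space M))"
      using bdd bdd_above_uminus[of "test_function A B ` (S \<times> space M)"]
      by (simp add: test_function_uminus image_image)
    moreover have "\<not> attains_max_on (test_function (\<lambda>p. - A p) B) (S \<times> space M)"
      using unattained by (simp add: attains_max_on_def attains_min_on_def test_function_uminus)
    ultimately obtain \<alpha> u where \<alpha>: "\<alpha> \<in> S" and u: "u \<in> space M" and \<Gamma>: "return M u \<in> \<Gamma>"
      and lower: "- inf_functional A B S \<Gamma> - ereal \<epsilon>
        < ereal (- ratio_functional A B \<alpha> (return M u))"
      and ratio: "ratio_functional A B \<alpha> (return M u) = A (\<alpha>, u) / B (\<alpha>, u)"
      and upper: "ereal (- (A (\<alpha>, u) / B (\<alpha>, u))) < - inf_functional A B S \<Gamma>"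
      using degenerate_near_sup[of M S \<Gamma> "\<lambda>p. - A p" B, OF singletons nonempty \<Gamma>_prob
          integrable_minus[OF A_integrable] B_integrable degenerate B_sign _ _ \<open>\<epsilon> > 0\<close>]
      unfolding sup_functional_uminus ratio_functional_uminus by auto
    (* An infinite infimum would contradict one of the two bounds. *)
    from lower upper
    have "inf_functional A B S \<Gamma> < ereal (A (\<alpha>, u) / B (\<alpha>, u)) \<and>
        ereal (A (\<alpha>, u) / B (\<alpha>, u)) < inf_functional A B S \<Gamma> + ereal \<epsilon>"
      unfolding ratio by (cases "inf_functional A B S \<Gamma>") auto
    with \<alpha> u \<Gamma> ratio
    show "\<exists>\<alpha>\<in>S. \<exists>u\<in>space M. return M u \<in> \<Gamma> \<and>
        inf_functional A B S \<Gamma> < ereal (ratio_functional A B \<alpha> (return M u)) \<and>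
        ratio_functional A B \<alpha> (return M u) = A (\<alpha>, u) / B (\<alpha>, u) \<and>
        ereal (A (\<alpha>, u) / B (\<alpha>, u)) < inf_functional A B S \<Gamma> + ereal \<epsilon>"
      by (intro bexI[OF _ \<alpha>] bexI[OF _ u]) simp
  }
qed

end
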